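(* Let $S$ be a left cancellative monoid with neutral element $e$, and let $R$ be a ring with an $S$-grading $\Gamma: R=\bigoplus_{g\in S}R_g$ of finite support, $|\mathrm{Supp}(\Gamma)|=d$. Suppose that $R_e$ is a nonzero nil ring. Then: (i) $R$ is $S$-nil. (ii) Suppose moreover that $R_e$ is nil of bounded index, with $\mathrm{nd}_{nil}(R_e)=s$. Then: (a) for every $g\in\mathrm{Supp}(\Gamma)$ and all $a_1,\dots,a_{k_g}\in R_g$, where $k_g=\min\{o(g),d\}$, one has $(a_1a_2\cdots a_{k_g})^s=0$; (b) there exists a positive integer $k$ such that $(a_1a_2\cdots a_k)^s=0$ for all homogeneous elements $a_1,\dots,a_k$ of the same homogeneous degree (that is, all lying in a common component $R_g$); (c) $R$ is $S$-nil of bounded index.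
   Context: Rings are associative, not necessarily with unity. A monoid $S$ is left cancellative if $gh=gt$ implies $h=t$ for all $g,h,t\in S$. An $S$-grading on $R$ is a decomposition $\Gamma: R=\bigoplus_{g\in S}R_g$ into additive subgroups with $R_gR_h\subseteq R_{gh}$ for all $g,h\in S$; its support is $\mathrm{Supp}(\Gamma)=\{g\in S: R_g\neq 0\}$. An element is homogeneous if it lies in some $R_g$. For $g\in S$, the order $o(g)$ is the smallest positive integer $n$ with $g^n=e$ if such $n$ exists, and $o(g)=\infty$ otherwise (so $o(e)=1$). A ring is nil if each of its elements is nilpotent; it is nil of bounded index if there is a single $n>0$ with $b^n=0$ for all its elements $b$, and then $\mathrm{nd}_{nil}$ denotes the smallest such $n$. An $S$-graded ring $R$ is $S$-nil if every homogeneous element is nilpotent, and $S$-nil of bounded index if there is a positive integer $k$ with $a^k=0$ for every homogeneous $a\in R$. *)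

theory Defs
  imports Complex_Main "HOL-Library.Extended_Nat"
begin

text \<open>
  The class \<open>ring\<close> is that of associative, possibly non-unital rings. It has no \<open>power\<close>
  operation, so products of nonempty lists and positive powers are introduced here. The values
  of \<open>nprod []\<close> and \<open>npow a 0\<close> are unspecified.
\<close>

fun nprod :: "'a::semigroup_mult list \<Rightarrow> 'a" where
  "nprod [a] = a"
| "nprod (a # b # as) = a * nprod (b # as)"

definition npow :: "'a::semigroup_mult \<Rightarrow> nat \<Rightarrow> 'a" where
  "npow a n = nprod (replicate n a)"

definition left_cancellative :: "'s::monoid_mult itself \<Rightarrow> bool" where
  "left_cancellative _ \<longleftrightarrow> (\<forall>g h t :: 's. g * h = g * t \<longrightarrow> h = t)"

definition mon_ord :: "'s::monoid_mult \<Rightarrow> enat" where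
  "mon_ord g = (if \<exists>n>0. g ^ n = 1 then enat (LEAST n. n > 0 \<and> g ^ n = 1) else \<infinity>)"

definition add_subgroup :: "'r::ring set \<Rightarrow> bool" where
  "add_subgroup A \<longleftrightarrow> 0 \<in> A \<and> (\<forall>x\<in>A. \<forall>y\<in>A. x + y \<in> A) \<and> (\<forall>x\<in>A. - x \<in> A)"

text \<open>
  A family \<open>\<Gamma>\<close> of components of the ring \<open>UNIV :: 'r set\<close>. The second conjunct says that the
  ring is the internal direct sum of the components.
\<close>

definition grading :: "('s::monoid_mult \<Rightarrow> 'r::ring set) \<Rightarrow> bool" where
  "grading \<Gamma> \<longleftrightarrow>
     (\<forall>g. add_subgroup (\<Gamma> g)) \<and>
     (\<forall>r. \<exists>!f. (\<forall>g. f g \<in> \<Gamma> g) \<and> finite {g. f g \<noteq> 0} \<and> r = (\<Sum>g | f g \<noteq> 0. f g)) \<and>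
     (\<forall>g h. \<forall>a\<in>\<Gamma> g. \<forall>b\<in>\<Gamma> h. a * b \<in> \<Gamma> (g * h))"

definition Supp :: "('s \<Rightarrow> 'r::ring set) \<Rightarrow> 's set" where
  "Supp \<Gamma> = {g. \<Gamma> g \<noteq> {0}}"

definition homogeneous :: "('s \<Rightarrow> 'r::ring set) \<Rightarrow> 'r \<Rightarrow> bool" where
  "homogeneous \<Gamma> a \<longleftrightarrow> (\<exists>g. a \<in> \<Gamma> g)"

definition nilpotent :: "'r::ring \<Rightarrow> bool" where
  "nilpotent a \<longleftrightarrow> (\<exists>n>0. npow a n = 0)"

definition nil :: "'r::ring set \<Rightarrow> bool" where
  "nil A \<longleftrightarrow> (\<forall>a\<in>A. nilpotent a)"

definition nil_bounded :: "'r::ring set \<Rightarrow> bool" where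
  "nil_bounded A \<longleftrightarrow> (\<exists>n>0. \<forall>b\<in>A. npow b n = 0)"

definition nd_nil :: "'r::ring set \<Rightarrow> nat" where
  "nd_nil A = (LEAST n. n > 0 \<and> (\<forall>b\<in>A. npow b n = 0))"

definition graded_nil :: "('s \<Rightarrow> 'r::ring set) \<Rightarrow> bool" where
  "graded_nil \<Gamma> \<longleftrightarrow> (\<forall>a. homogeneous \<Gamma> a \<longrightarrow> nilpotent a)"

definition graded_nil_bounded :: "('s \<Rightarrow> 'r::ring set) \<Rightarrow> bool" where
  "graded_nil_bounded \<Gamma> \<longleftrightarrow> (\<exists>k>0. \<forall>a. homogeneous \<Gamma> a \<longrightarrow> npow a k = 0)"

end

theory Submission
  imports Defs
begin

text \<open>
  Let \<open>g\<close> be a degree and \<open>d\<close> the size of the support. If \<open>g ^ n = 1\<close> for some \<open>0 < n \<le> d\<close>, then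
  products of \<open>n\<close> elements of degree \<open>g\<close> lie in the identity component. Otherwise left
  cancellation makes \<open>1, g, \<dots>, g ^ d\<close> pairwise distinct, so that one of these \<open>d + 1\<close> elements
  is outside the support; it is not \<open>1\<close>, hence every product of \<open>d\<close> elements of degree \<open>g\<close> has
  a vanishing initial segment. Either way a product of \<open>d!\<close> elements of a common degree lies
  in the identity component.
\<close>

lemma nprod_Cons: "as \<noteq> [] \<Longrightarrow> nprod (a # as) = a * nprod as"
  by (cases as) auto

lemma nprod_append:
  "as \<noteq> [] \<Longrightarrow> bs \<noteq> [] \<Longrightarrow> nprod (as @ bs) = nprod as * nprod bs"
proof (induction as)
  case (Cons a as)
  then show ?case
    by (cases "as = []") (auto simp: nprod_Cons mult.assoc)
qed simp

lemma npow_1: "npow a (Suc 0) = a"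
  by (simp add: npow_def)

lemma npow_Suc: "n > 0 \<Longrightarrow> npow a (Suc n) = a * npow a n"
  by (simp add: npow_def nprod_Cons)

lemma npow_add: "m > 0 \<Longrightarrow> n > 0 \<Longrightarrow> npow a (m + n) = npow a m * npow a n"
  by (simp add: npow_def replicate_add nprod_append)

lemma npow_npow:
  assumes "m > 0" "n > 0"
  shows "npow (npow a m) n = npow a (m * n)"
  using \<open>n > 0\<close>
proof (induction n rule: nat_induct_non_zero)
  case 1
  show ?case by (simp add: npow_1)
next
  case (Suc n)
  then show ?case using \<open>m > 0\<close> by (simp add: npow_Suc npow_add)
qed

lemma mon_ord_eq_enatD:
  assumes "mon_ord g = enat n"
  shows "n > 0" "g ^ n = 1"
proof -
  from assms have ex: "\<exists>n>0. g ^ n = 1" and n: "n = (LEAST n. n > 0 \<and> g ^ n = 1)"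
    by (auto simp: mon_ord_def split: if_splits)
  from LeastI_ex[OF ex] show "n > 0" "g ^ n = 1" by (simp_all add: n)
qed

lemma mon_ord_le: "n > 0 \<Longrightarrow> g ^ n = 1 \<Longrightarrow> mon_ord g \<le> enat n"
  by (auto simp: mon_ord_def intro: Least_le)

text \<open>If two powers with exponents \<open>i < j\<close> coincide, cancelling
  \<open>g ^ i\<close> on the left leaves \<open>1 = g ^ (j - i)\<close> with
  \<open>0 < j - i \<le> d\<close>.\<close>

lemma inj_on_power_if_no_small_order:
  fixes g :: "'s::monoid_mult"
  assumes "left_cancellative TYPE('s)" and "\<And>n. 0 < n \<Longrightarrow> n \<le> d \<Longrightarrow> g ^ n \<noteq> 1"
  shows "inj_on (\<lambda>i. g ^ i) {0..d}"
proof (rule linorder_inj_onI)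
  fix i j assume ij: "i < j" "i \<in> {0..d}" "j \<in> {0..d}"
  show "g ^ i \<noteq> g ^ j"
  proof
    assume "g ^ i = g ^ j"
    moreover have "g ^ j = g ^ i * g ^ (j - i)"
      using ij by (simp flip: power_add)
    ultimately have "g ^ i * 1 = g ^ i * g ^ (j - i)" by simp
    then have "1 = g ^ (j - i)"
      using assms(1) unfolding left_cancellative_def by blast
    moreover have "0 < j - i" "j - i \<le> d" using ij by auto
    ultimately show False using assms(2) by metis
  qed
qed auto

lemma grading_zero_mem: "grading \<Gamma> \<Longrightarrow> 0 \<in> \<Gamma> g"
  by (simp add: grading_def add_subgroup_def)

lemma nprod_mem_component:
  assumes "grading \<Gamma>" "as \<noteq> []" "set as \<subseteq> \<Gamma> g"
  shows "nprod as \<in> \<Gamma> (g ^ length as)"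
  using assms(2,3)
proof (induction as rule: list_nonempty_induct)
  case (cons a as)
  then have "a * nprod as \<in> \<Gamma> (g * g ^ length as)"
    using assms(1) by (auto simp: grading_def)
  then show ?case using cons.hyps by (simp add: nprod_Cons)
qed simp

lemma nprod_eq_0_if_power_notin_Supp:
  assumes gr: "grading \<Gamma>" and sub: "set as \<subseteq> \<Gamma> g"
    and i: "0 < i" "i \<le> length as" and out: "g ^ i \<notin> Supp \<Gamma>"
  shows "nprod as = 0"
proof -
  have "set (take i as) \<subseteq> \<Gamma> g"
    using sub set_take_subset[of i as] by blast
  moreover have "take i as \<noteq> []" using i by auto
  ultimately have "nprod (take i as) \<in> \<Gamma> (g ^ i)"
    using nprod_mem_component[OF gr, of "take i as" g] i by (simp add: min_absorb2)
  then have z: "nprod (take i as) = 0"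
    using out by (simp add: Supp_def)
  \<comment> \<open>The case \<open>i = length as\<close> is separate because
    \<open>nprod []\<close> is unspecified, so the product cannot be split at an empty tail.\<close>
  show ?thesis
  proof (cases "drop i as = []")
    case True
    with z show ?thesis by simp
  next
    case False
    with i have "nprod (take i as @ drop i as) = nprod (take i as) * nprod (drop i as)"
      by (intro nprod_append) auto
    with z show ?thesis by simp
  qed
qed

lemma nprod_eq_0_if_no_small_order:
  fixes \<Gamma> :: "'s::monoid_mult \<Rightarrow> 'r::ring set"
  assumes "left_cancellative TYPE('s)" and gr: "grading \<Gamma>"
    and fin: "finite (Supp \<Gamma>)" and ne: "\<Gamma> 1 \<noteq> {0}"
    and no: "\<And>n. 0 < n \<Longrightarrow> n \<le> card (Supp \<Gamma>) \<Longrightarrow> g ^ n \<noteq> 1"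
    and sub: "set as \<subseteq> \<Gamma> g" and len: "card (Supp \<Gamma>) \<le> length as"
  shows "nprod as = 0"
proof -
  let ?d = "card (Supp \<Gamma>)"
  have "card ((\<lambda>i. g ^ i) ` {0..?d}) = Suc ?d"
    using inj_on_power_if_no_small_order[OF assms(1) no] by (simp add: card_image)
  \<comment> \<open>Pigeonhole: \<open>?d + 1\<close> distinct powers cannot all lie in a set of
    size \<open>?d\<close>.\<close>
  then have "\<not> (\<lambda>i. g ^ i) ` {0..?d} \<subseteq> Supp \<Gamma>"
    using card_mono[OF fin, of "(\<lambda>i. g ^ i) ` {0..?d}"] by linarith
  then obtain i where i: "i \<le> ?d" "g ^ i \<notin> Supp \<Gamma>"
    by (metis atLeastAtMost_iff image_subsetI)
  \<comment> \<open>The exponent 0 gives the degree 1, which is in the support because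
    \<open>\<Gamma> 1\<close> is nonzero. Thus the vanishing initial segment is nonempty.\<close>
  moreover have "i \<noteq> 0"
    using i(2) ne by (metis (mono_tags) Supp_def mem_Collect_eq power_0)
  ultimately show ?thesis
    using nprod_eq_0_if_power_notin_Supp[OF gr sub, of i] len by simp
qed

text \<open>The factorial gives one length that serves all degrees \<open>g\<close>: it is divisible
  by every exponent \<open>n\<close> with \<open>0 < n \<le> d\<close>, where \<open>d\<close> is
  the size of the support, and it is at least \<open>d\<close>.\<close>

lemma nprod_fact_mem_one_component:
  fixes \<Gamma> :: "'s::monoid_mult \<Rightarrow> 'r::ring set"
  assumes "left_cancellative TYPE('s)" and gr: "grading \<Gamma>"
    and "finite (Supp \<Gamma>)" and "\<Gamma> 1 \<noteq> {0}"
    and sub: "set as \<subseteq> \<Gamma> g" and len: "length as = fact (card (Supp \<Gamma>))"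
  shows "nprod as \<in> \<Gamma> 1"
proof (cases "\<exists>n. 0 < n \<and> n \<le> card (Supp \<Gamma>) \<and> g ^ n = 1")
  case True
  then obtain n where n: "0 < n" "n \<le> card (Supp \<Gamma>)" "g ^ n = 1" by blast
  then have "n dvd length as" by (simp add: len dvd_fact)
  then have "g ^ length as = 1" using n(3) by (auto simp: power_mult)
  moreover have "as \<noteq> []" using len by auto
  ultimately show ?thesis using nprod_mem_component[OF gr _ sub] by simp
next
  case False
  moreover have "card (Supp \<Gamma>) \<le> length as" by (simp add: len fact_ge_self)
  ultimately have "nprod as = 0"
    using nprod_eq_0_if_no_small_order[OF assms(1-4) _ sub] by blast
  then show ?thesis using grading_zero_mem[OF gr] by simp
qed

text \<open>If the order is at most the size of the support, the minimum is the order itself and the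
  product has degree 1. Otherwise no small positive power of \<open>g\<close> is 1 and the product
  vanishes.\<close>

lemma nprod_min_order_mem_one_component:
  fixes \<Gamma> :: "'s::monoid_mult \<Rightarrow> 'r::ring set"
  assumes "left_cancellative TYPE('s)" and gr: "grading \<Gamma>"
    and "finite (Supp \<Gamma>)" and "\<Gamma> 1 \<noteq> {0}"
    and sub: "set as \<subseteq> \<Gamma> g"
    and len: "enat (length as) = min (mon_ord g) (enat (card (Supp \<Gamma>)))"
  shows "nprod as \<in> \<Gamma> 1"
proof (cases "mon_ord g \<le> enat (card (Supp \<Gamma>))")
  case True
  then have "mon_ord g = enat (length as)" using len by (simp add: min_def)
  from mon_ord_eq_enatD[OF this] nprod_mem_component[OF gr _ sub] show ?thesis by auto
next
  case False
  then have "length as = card (Supp \<Gamma>)" using len by (simp add: min_def)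
  moreover have "g ^ n \<noteq> 1" if "0 < n" "n \<le> card (Supp \<Gamma>)" for n
    using mon_ord_le[of n g] that False by (meson enat_ord_simps(1) order_trans)
  ultimately have "nprod as = 0"
    using nprod_eq_0_if_no_small_order[OF assms(1-4) _ sub] by simp
  then show ?thesis using grading_zero_mem[OF gr] by simp
qed

theorem proposition3p5:
  fixes \<Gamma> :: "'s::monoid_mult \<Rightarrow> 'r::ring set" and d :: nat
  assumes "left_cancellative TYPE('s)"
    and "grading \<Gamma>"
    and "finite (Supp \<Gamma>)" and "card (Supp \<Gamma>) = d"
    and "\<Gamma> 1 \<noteq> {0}" and "nil (\<Gamma> 1)"
  shows "graded_nil \<Gamma> \<and>
    (\<forall>s. nil_bounded (\<Gamma> 1) \<and> nd_nil (\<Gamma> 1) = s \<longrightarrow>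
       (\<forall>g\<in>Supp \<Gamma>. \<forall>as. enat (length as) = min (mon_ord g) (enat d) \<and> set as \<subseteq> \<Gamma> g \<longrightarrow>
          npow (nprod as) s = 0) \<and>
       (\<exists>k>0. \<forall>g as. length as = k \<and> set as \<subseteq> \<Gamma> g \<longrightarrow> npow (nprod as) s = 0) \<and>
       graded_nil_bounded \<Gamma>)"
proof (intro conjI allI impI)
  note pow = nprod_fact_mem_one_component[OF assms(1,2,3,5), unfolded assms(4)]
  note ord = nprod_min_order_mem_one_component[OF assms(1,2,3,5), unfolded assms(4)]
  \<comment> \<open>A power is the product of a constant list, whose entries trivially share a
    degree.\<close>
  have hom: "npow a (fact d) \<in> \<Gamma> 1" if "homogeneous \<Gamma> a" for a
    using that pow[of "replicate (fact d) a"] by (auto simp: homogeneous_def npow_def)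
  show "graded_nil \<Gamma>"
    unfolding graded_nil_def
  proof (intro allI impI)
    fix a assume "homogeneous \<Gamma> a"
    with hom assms(6) obtain n where "n > 0" "npow (npow a (fact d)) n = 0"
      by (auto simp: nil_def nilpotent_def)
    then show "nilpotent a"
      unfolding nilpotent_def by (intro exI[of _ "fact d * n"]) (simp add: npow_npow)
  qed
  fix s assume s: "nil_bounded (\<Gamma> 1) \<and> nd_nil (\<Gamma> 1) = s"
  then have ex: "\<exists>n. n > 0 \<and> (\<forall>b\<in>\<Gamma> 1. npow b n = 0)"
    by (simp add: nil_bounded_def)
  \<comment> \<open>Bounded index supplies a witness for the \<open>LEAST\<close> in
    \<open>nd_nil\<close>, so the minimum \<open>s\<close> is itself a valid exponent.\<close>
  have "s > 0 \<and> (\<forall>b\<in>\<Gamma> 1. npow b s = 0)"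
    using LeastI_ex[OF ex] s by (simp add: nd_nil_def)
  then have s0: "s > 0" and nilp: "\<And>b. b \<in> \<Gamma> 1 \<Longrightarrow> npow b s = 0" by auto
  show "\<forall>g\<in>Supp \<Gamma>. \<forall>as. enat (length as) = min (mon_ord g) (enat d) \<and> set as \<subseteq> \<Gamma> g \<longrightarrow>
      npow (nprod as) s = 0"
    using ord nilp by blast
  show "\<exists>k>0. \<forall>g as. length as = k \<and> set as \<subseteq> \<Gamma> g \<longrightarrow> npow (nprod as) s = 0"
    using pow nilp by (intro exI[of _ "fact d"]) auto
  show "graded_nil_bounded \<Gamma>"
    unfolding graded_nil_bounded_def
    \<comment> \<open>The exponent \<open>fact d * s\<close> works because
      \<open>npow a (fact d)\<close> lies in \<open>\<Gamma> 1\<close>, where \<open>s\<close>-th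
      powers vanish.\<close>
    using hom nilp s0 by (intro exI[of _ "fact d * s"]) (auto simp: npow_npow[symmetric])
qed

end
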